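(* Every spherical body $W\subset S^2$ of constant width at least $\frac{\pi}{2}$ is contained in a disk of radius $$\Delta(W)+\arcsin\left(\frac{2\sqrt{3}}{3}\cdot\cos\frac{\Delta(W)}{2}\right)-\frac{\pi}{2}.$$
   Context: $S^2$ is the unit sphere in $E^3$ with spherical (geodesic) distance. For non-antipodal $a,b$, the arc $ab$ is the shorter part of the great circle through $a,b$. A set $C\subset S^2$ is convex if it contains no pair of antipodes and $ab\subset C$ for all $a,b\in C$. A convex body is a closed convex set with non-empty interior. A disk of radius $\rho$ is the set of points at distance at most $\rho$ from a point (its center). A hemisphere is a disk of radius $\frac{\pi}{2}$. A hemisphere $K$ supports $C$ if $C\subset K$ and $\mathrm{bd}(C)\cap\mathrm{bd}(K)\neq\emptyset$. If hemispheres $G,H$ are different and not opposite (centers not antipodal), $L=G\cap H$ is a lune, bounded by the semicircles $\mathrm{bd}(G)\cap H$ and $\mathrm{bd}(H)\cap G$. Its thickness $\Delta(L)$ is the spherical distance between the centers (midpoints) of these semicircles. For a hemisphere $K$ supporting $C$, $\mathrm{width}_K(C)$ is the minimum of $\Delta(K\cap K')$ over all hemispheres $K'$ supporting $C$ for which $K\cap K'$ is a lune. The thickness $\Delta(C)$ is the minimum of $\mathrm{width}_K(C)$ over all hemispheres $K$ supporting $C$. A body of constant width is a convex body $W$ for which $\mathrm{width}_K(W)$ has the same value for all hemispheres $K$ supporting $W$. This value is the constant width and equals $\Delta(W)$. *)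

theory Defs
  imports "HOL-Analysis.Analysis"
begin

abbreviation S2 :: "(real^3) set" where
  "S2 \<equiv> sphere 0 1"

definition sdist :: "real^3 \<Rightarrow> real^3 \<Rightarrow> real" where
  "sdist a b = arccos (a \<bullet> b)"

abbreviation sph_boundary :: "(real^3) set \<Rightarrow> (real^3) set" where
  "sph_boundary C \<equiv> (top_of_set S2) frontier_of C"

text \<open>
  For \<open>a, b \<in> S2\<close> with \<open>b \<noteq> - a\<close>, the points of the great circle through \<open>a\<close> and \<open>b\<close>
  that lie on its shorter part are those at which the distances to \<open>a\<close> and \<open>b\<close> add up to
  \<open>sdist a b\<close>; on the longer part the sum is strictly larger. For \<open>b = a\<close> this is \<open>{a}\<close>.
\<close>

definition sph_arc :: "real^3 \<Rightarrow> real^3 \<Rightarrow> (real^3) set" where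
  "sph_arc a b = {x \<in> S2 \<inter> span {a, b}. sdist a x + sdist x b = sdist a b}"

definition sph_convex :: "(real^3) set \<Rightarrow> bool" where
  "sph_convex C \<longleftrightarrow>
     C \<subseteq> S2 \<and> (\<forall>a\<in>C. - a \<notin> C) \<and> (\<forall>a\<in>C. \<forall>b\<in>C. sph_arc a b \<subseteq> C)"

definition sph_convex_body :: "(real^3) set \<Rightarrow> bool" where
  "sph_convex_body C \<longleftrightarrow>
     sph_convex C \<and> closedin (top_of_set S2) C \<and> (top_of_set S2) interior_of C \<noteq> {}"

definition sph_disk :: "real^3 \<Rightarrow> real \<Rightarrow> (real^3) set" where
  "sph_disk c \<rho> = {x \<in> S2. sdist c x \<le> \<rho>}"

definition hemisphere :: "(real^3) set \<Rightarrow> bool" where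
  "hemisphere K \<longleftrightarrow> (\<exists>c\<in>S2. K = sph_disk c (pi / 2))"

definition supports :: "(real^3) set \<Rightarrow> (real^3) set \<Rightarrow> bool" where
  "supports K C \<longleftrightarrow>
     hemisphere K \<and> C \<subseteq> K \<and> sph_boundary C \<inter> sph_boundary K \<noteq> {}"

text \<open>The hemispheres \<open>G\<close> and \<open>H\<close> are different and not opposite, so \<open>G \<inter> H\<close> is a lune.\<close>

definition lune_pair :: "(real^3) set \<Rightarrow> (real^3) set \<Rightarrow> bool" where
  "lune_pair G H \<longleftrightarrow>
     (\<exists>g\<in>S2. \<exists>h\<in>S2. G = sph_disk g (pi / 2) \<and> H = sph_disk h (pi / 2) \<and> g \<noteq> h \<and> g \<noteq> - h)"

text \<open>
  The midpoint of the semicircle \<open>bd(G) \<inter> H\<close>: its point equidistant from the two endpoints,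
  which form the set \<open>bd(G) \<inter> bd(H)\<close>. It is unique whenever \<open>lune_pair G H\<close>.
\<close>

definition semicircle_center :: "(real^3) set \<Rightarrow> (real^3) set \<Rightarrow> real^3" where
  "semicircle_center G H =
     (THE m. m \<in> sph_boundary G \<inter> H \<and>
        (\<forall>e \<in> sph_boundary G \<inter> sph_boundary H. \<forall>e' \<in> sph_boundary G \<inter> sph_boundary H.
           sdist m e = sdist m e'))"

text \<open>Thickness of the lune \<open>G \<inter> H\<close>, given by the pair \<open>G\<close>, \<open>H\<close> that it determines.\<close>

definition lune_thickness :: "(real^3) set \<Rightarrow> (real^3) set \<Rightarrow> real" where
  "lune_thickness G H = sdist (semicircle_center G H) (semicircle_center H G)"

text \<open>
  For a convex body, compactness of its set of supporting hemispheres makes both infima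
  below attained, so they are the minima in the definitions of width and thickness. Their
  index sets are nonempty: a convex body contains no antipodes, hence is not a hemisphere and
  has at least two supporting hemispheres, and its nonempty interior excludes opposite ones.
\<close>

definition sph_width :: "(real^3) set \<Rightarrow> (real^3) set \<Rightarrow> real" where
  "sph_width K C = Inf {lune_thickness K K' | K'. supports K' C \<and> lune_pair K K'}"

definition sph_thickness :: "(real^3) set \<Rightarrow> real" where
  "sph_thickness C = Inf {sph_width K C | K. supports K C}"

text \<open>The common value of the widths of such a \<open>W\<close> is \<open>sph_thickness W\<close>.\<close>

definition sph_constant_width :: "(real^3) set \<Rightarrow> bool" where
  "sph_constant_width W \<longleftrightarrow>
     sph_convex_body W \<and>
     (\<forall>K K'. supports K W \<longrightarrow> supports K' W \<longrightarrow> sph_width K W = sph_width K' W)"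

end

theory Submission
  imports Defs
begin

text \<open>
  Let \<open>B\<close> be the set of centers of the hemispheres that support \<open>W\<close>. The lune cut out by two
  hemispheres with centers \<open>g\<close> and \<open>h\<close> has thickness \<open>\<pi> - sdist g h\<close> (\<open>lune_thickness_eq\<close>), so
  constant width \<open>w\<close> of \<open>W\<close> turns into a statement about distances in \<open>B\<close>, with \<open>d = \<pi> - w\<close>: no
  two points of \<open>B\<close> are farther apart than \<open>d\<close>, and every point of \<open>B\<close> has points of \<open>B\<close> at
  distance arbitrarily close to \<open>d\<close> (\<open>sdist_support_centers_le\<close>, \<open>ex_far_support_center\<close>).

  Jung's theorem on the sphere (\<open>spherical_jung_disk\<close>) encloses \<open>B\<close> in a disk of radius
  \<open>R = arcsin (2 / sqrt 3 * sin (d / 2))\<close>. Its center \<open>c\<close> is the direction of a point of the convex hull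
  of \<open>B\<close>, so the hemisphere centered at \<open>c\<close> contains \<open>W\<close>.

  The same point \<open>c\<close> is the center of the disk for \<open>W\<close>. Let \<open>y\<close> be a point of \<open>W\<close> farthest from \<open>c\<close>.
  Rotating \<open>c\<close> directly away from \<open>y\<close> until \<open>y\<close> lies on the boundary circle gives a center \<open>k\<close> in \<open>B\<close> at
  distance \<open>\<pi> / 2 - sdist c y\<close> from \<open>c\<close>. All points of \<open>B\<close> are then within
  \<open>\<pi> / 2 - sdist c y + R\<close> of \<open>k\<close>, while \<open>k\<close> has points of \<open>B\<close> almost at distance \<open>d\<close>. Hence
  \<open>sdist c y \<le> \<pi> / 2 - d + R\<close>, and since \<open>sin (d / 2) = cos (w / 2)\<close> this is the asserted radius.
\<close>

section \<open>Distances between unit vectors\<close>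

lemma abs_inner_S2_le_1: "a \<in> S2 \<Longrightarrow> b \<in> S2 \<Longrightarrow> \<bar>a \<bullet> b\<bar> \<le> 1"
  using Cauchy_Schwarz_ineq2[of a b] by simp

lemma inner_S2_bounds:
  assumes "a \<in> S2" "b \<in> S2"
  shows "-1 \<le> a \<bullet> b" "a \<bullet> b \<le> 1"
  using abs_inner_S2_le_1[OF assms] by auto

lemma inner_S2_eq_1_iff:
  assumes "a \<in> S2" "b \<in> S2"
  shows "a \<bullet> b = 1 \<longleftrightarrow> a = b"
proof
  assume "a \<bullet> b = 1"
  then have "(a - b) \<bullet> (a - b) = 0"
    using assms by (simp add: norm_eq_1 inner_diff inner_commute)
  then show "a = b" by simp
qed (use assms in \<open>simp add: norm_eq_1\<close>)

lemma inner_S2_eq_minus_1_iff: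
  assumes "a \<in> S2" "b \<in> S2"
  shows "a \<bullet> b = -1 \<longleftrightarrow> a = - b"
  using inner_S2_eq_1_iff[of a "- b"] assms by auto

lemma square_inner_S2_less_1:
  assumes "a \<in> S2" "b \<in> S2" "a \<noteq> b" "a \<noteq> - b"
  shows "(a \<bullet> b)\<^sup>2 < 1"
proof -
  have "\<bar>a \<bullet> b\<bar> < 1"
    using inner_S2_bounds[OF assms(1,2)] inner_S2_eq_1_iff[OF assms(1,2)]
      inner_S2_eq_minus_1_iff[OF assms(1,2)] assms(3,4) by linarith
  then show ?thesis by (simp add: abs_square_less_1)
qed

lemma sgn_in_S2: "v \<noteq> 0 \<Longrightarrow> sgn v \<in> S2"
  by (simp add: norm_sgn)

lemma inner_sgn: "x \<bullet> sgn v = (x \<bullet> v) / norm v" for x v :: "real^3"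
  by (simp add: sgn_div_norm divide_inverse)

lemma sdist_le_cos:
  assumes "a \<in> S2" "b \<in> S2" "0 \<le> t" "t \<le> pi" "cos t \<le> a \<bullet> b"
  shows "sdist a b \<le> t"
  using arccos_le_arccos[of "cos t" "a \<bullet> b"] assms inner_S2_bounds[of a b]
  by (simp add: sdist_def arccos_cos)

lemma cos_sdist: "a \<in> S2 \<Longrightarrow> b \<in> S2 \<Longrightarrow> cos (sdist a b) = a \<bullet> b"
  by (simp add: sdist_def inner_S2_bounds)

lemma sdist_bounds:
  assumes "a \<in> S2" "b \<in> S2"
  shows "0 \<le> sdist a b" "sdist a b \<le> pi"
  using arccos_bounded inner_S2_bounds[OF assms] by (auto simp: sdist_def)

lemma sdist_commute: "sdist a b = sdist b a"
  by (simp add: sdist_def inner_commute)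

lemma arccos_add_le_pi:
  assumes "\<bar>u\<bar> \<le> 1" "\<bar>v\<bar> \<le> 1" "0 \<le> u + v"
  shows "arccos u + arccos v \<le> pi"
  using arccos_le_mono[of u "- v"] arccos_minus[of v] assms by force

text \<open>
  Let \<open>\<alpha>\<close> and \<open>\<beta>\<close> be the distances of \<open>a\<close> and \<open>b\<close> to \<open>c\<close>. Splitting \<open>a\<close> and \<open>b\<close> into their components
  along \<open>c\<close> and orthogonal to it, \<open>a \<bullet> b\<close> is at least \<open>cos \<alpha> cos \<beta> - sin \<alpha> sin \<beta>\<close> by Cauchy--Schwarz on the orthogonal components.
\<close>

lemma sdist_triangle:
  assumes "a \<in> S2" "b \<in> S2" "c \<in> S2"
  shows "sdist a b \<le> sdist a c + sdist c b"
proof (cases "sdist a c + sdist c b \<le> pi")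
  case True
  define u where "u = a - (a \<bullet> c) *\<^sub>R c"
  define v where "v = b - (c \<bullet> b) *\<^sub>R c"
  have n: "a \<bullet> a = 1" "b \<bullet> b = 1" "c \<bullet> c = 1"
    using assms by (auto simp: norm_eq_1)
  have uu: "u \<bullet> u = 1 - (a \<bullet> c)\<^sup>2" and vv: "v \<bullet> v = 1 - (c \<bullet> b)\<^sup>2"
    and uv: "u \<bullet> v = a \<bullet> b - (a \<bullet> c) * (c \<bullet> b)"
    unfolding u_def v_def using n
    by (simp_all add: inner_diff inner_commute power2_eq_square)
  have "norm u = sin (sdist a c)" "norm v = sin (sdist c b)"
    using uu vv abs_inner_S2_le_1[OF assms(1,3)] abs_inner_S2_le_1[OF assms(3,2)]
    by (simp_all add: norm_eq_sqrt_inner sdist_def sin_arccos_abs)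
  then have "- (sin (sdist a c) * sin (sdist c b)) \<le> u \<bullet> v"
    using Cauchy_Schwarz_ineq2[of u v] by simp
  then have "cos (sdist a c + sdist c b) \<le> a \<bullet> b"
    using uv assms by (simp add: cos_add cos_sdist)
  then show ?thesis
    using True assms by (intro sdist_le_cos) (auto simp: sdist_bounds)
next
  case False
  then show ?thesis using sdist_bounds[OF assms(1,2)] by linarith
qed

section \<open>Hemispheres and lunes\<close>

lemma hemisphere_eq_halfspace:
  assumes "c \<in> S2"
  shows "sph_disk c (pi / 2) = {x \<in> S2. 0 \<le> c \<bullet> x}"
proof -
  have "sdist c x \<le> pi / 2 \<longleftrightarrow> 0 \<le> c \<bullet> x" if "x \<in> S2" for x
    using arccos_le_mono[of "c \<bullet> x" 0] abs_inner_S2_le_1[OF assms that] by (simp add: sdist_def)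
  then show ?thesis by (auto simp: sph_disk_def)
qed

text \<open>
  Pushing a point \<open>x\<close> of the great circle \<open>c \<bullet> x = 0\<close> slightly towards \<open>- c\<close> and normalizing gives
  points outside the hemisphere that converge to \<open>x\<close>.
\<close>

lemma interior_of_hemisphere:
  assumes "c \<in> S2"
  shows "(top_of_set S2) interior_of {x \<in> S2. 0 \<le> c \<bullet> x} = {x \<in> S2. 0 < c \<bullet> x}"
proof (rule interior_of_unique)
  show "openin (top_of_set S2) {x \<in> S2. 0 < c \<bullet> x}"
  proof -
    have "{x \<in> S2. 0 < c \<bullet> x} = S2 \<inter> {x. 0 < c \<bullet> x}" by auto
    then show ?thesis
      by (metis open_halfspace_gt openin_open_Int)
  qed
next
  fix T assume T: "T \<subseteq> {x \<in> S2. 0 \<le> c \<bullet> x}" "openin (top_of_set S2) T"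
  show "T \<subseteq> {x \<in> S2. 0 < c \<bullet> x}"
  proof
    fix x assume x: "x \<in> T"
    then have xS: "x \<in> S2" and cx: "0 \<le> c \<bullet> x" using T by auto
    have "c \<bullet> x \<noteq> 0"
    proof
      assume cx0: "c \<bullet> x = 0"
      obtain U where U: "open U" "T = S2 \<inter> U"
        using T(2) by (auto simp: openin_open)
      define f where "f t = sgn (x - t *\<^sub>R c)" for t :: real
      have x0: "x \<noteq> 0" using xS by auto
      have "((\<lambda>t. x - t *\<^sub>R c) \<longlongrightarrow> x - 0 *\<^sub>R c) (at_right 0)"
        by (intro tendsto_intros)
      then have "(f \<longlongrightarrow> sgn x) (at_right 0)"
        unfolding f_def using x0 by (intro tendsto_sgn) auto
      moreover have "sgn x = x" using xS by (simp add: sgn_div_norm)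
      ultimately have "\<forall>\<^sub>F t in at_right 0. f t \<in> U"
        using U x topological_tendstoD by fastforce
      moreover have "\<forall>\<^sub>F t in at_right (0::real). 0 < t"
        by (simp add: eventually_at_right_less)
      ultimately have "\<forall>\<^sub>F t in at_right 0. f t \<in> U \<and> 0 < t"
        by (rule eventually_conj)
      then obtain t where t: "f t \<in> U" "0 < t"
        using eventually_happens trivial_limit_at_right_real by blast
      have cc: "c \<bullet> (x - t *\<^sub>R c) = - t"
        using assms cx0 by (simp add: inner_diff norm_eq_1)
      then have nz: "x - t *\<^sub>R c \<noteq> 0" using t(2) by auto
      then have "f t \<in> T"
        using t(1) U sgn_in_S2[OF nz] unfolding f_def by auto
      then have "0 \<le> c \<bullet> f t" using T by auto
      then show False
        using nz t(2) divide_pos_pos[of t "norm (x - t *\<^sub>R c)"]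
        unfolding f_def inner_sgn cc by (simp del: divide_pos_pos)
    qed
    with xS cx show "x \<in> {x \<in> S2. 0 < c \<bullet> x}" by auto
  qed
qed auto

lemma sph_boundary_hemisphere:
  assumes "c \<in> S2"
  shows "sph_boundary (sph_disk c (pi / 2)) = {x \<in> S2. c \<bullet> x = 0}"
proof -
  have "{x \<in> S2. 0 \<le> c \<bullet> x} = S2 \<inter> {x. 0 \<le> c \<bullet> x}" by auto
  also have "closedin (top_of_set S2) \<dots>"
    by (intro closedin_closed_Int closed_halfspace_ge)
  finally have closure: "(top_of_set S2) closure_of {x \<in> S2. 0 \<le> c \<bullet> x} = {x \<in> S2. 0 \<le> c \<bullet> x}"
    by (rule closure_of_closedin)
  have "{x \<in> S2. 0 \<le> c \<bullet> x} - {x \<in> S2. 0 < c \<bullet> x} = {x \<in> S2. c \<bullet> x = 0}"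
    by auto
  then show ?thesis
    unfolding frontier_of_def hemisphere_eq_halfspace[OF assms] interior_of_hemisphere[OF assms] closure .
qed

text \<open>
  The unit vector orthogonal to \<open>k\<close> in the direction of \<open>v\<close>: for unit vectors, the point of the
  great circle with pole \<open>k\<close> nearest to \<open>v\<close>.
\<close>

definition polar_projection :: "real^3 \<Rightarrow> real^3 \<Rightarrow> real^3" where
  "polar_projection k v = sgn (v - (k \<bullet> v) *\<^sub>R k)"

context
  fixes k v :: "real^3"
  assumes kv: "k \<in> S2" "v \<in> S2" "k \<noteq> v" "k \<noteq> - v"
begin

lemma norm_orthogonal_component: "norm (v - (k \<bullet> v) *\<^sub>R k) = sqrt (1 - (k \<bullet> v)\<^sup>2)"
  using kv(1,2) by (simp add: norm_eq_sqrt_inner norm_eq_1 inner_diff inner_commute power2_eq_square)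

lemma sqrt_component_pos: "0 < sqrt (1 - (k \<bullet> v)\<^sup>2)"
  using square_inner_S2_less_1[OF kv] by simp

lemma polar_projection_in_S2: "polar_projection k v \<in> S2"
  unfolding polar_projection_def
proof (rule sgn_in_S2)
  show "v - (k \<bullet> v) *\<^sub>R k \<noteq> 0"
    using norm_orthogonal_component sqrt_component_pos by (metis norm_zero less_irrefl)
qed

lemma inner_polar_projection:
  "x \<bullet> polar_projection k v = (x \<bullet> v - (k \<bullet> v) * (x \<bullet> k)) / sqrt (1 - (k \<bullet> v)\<^sup>2)"
  unfolding polar_projection_def inner_sgn norm_orthogonal_component by (simp add: inner_diff)

lemma inner_polar_projection_pole: "k \<bullet> polar_projection k v = 0"
  using kv by (simp add: inner_polar_projection norm_eq_1)

lemma inner_polar_projection_self: "v \<bullet> polar_projection k v = sqrt (1 - (k \<bullet> v)\<^sup>2)"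
proof -
  have "v \<bullet> v - (k \<bullet> v) * (v \<bullet> k) = 1 - (k \<bullet> v)\<^sup>2"
    using kv by (simp add: norm_eq_1 inner_commute power2_eq_square)
  then show ?thesis
    using sqrt_component_pos unfolding inner_polar_projection by (simp add: real_div_sqrt)
qed

end

lemma sph_disk_half_pi_inj:
  assumes "g \<in> S2" "h \<in> S2" "sph_disk g (pi / 2) = sph_disk h (pi / 2)"
  shows "g = h"
proof (rule ccontr)
  assume ne: "g \<noteq> h"
  have iff: "0 \<le> g \<bullet> x \<longleftrightarrow> 0 \<le> h \<bullet> x" if "x \<in> S2" for x
    using assms(3) that
    by (auto simp: hemisphere_eq_halfspace[OF assms(1)] hemisphere_eq_halfspace[OF assms(2)])
  show False
  proof (cases "g = - h")
    case True
    then show ?thesis using iff[of g] assms by (auto simp: norm_eq_1)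
  next
    case False
    \<comment> \<open>The point of the boundary circle of \<open>g\<close> farthest from \<open>h\<close> lies in one hemisphere only.\<close>
    let ?x = "- polar_projection g h"
    have "g \<bullet> ?x = 0" "h \<bullet> ?x < 0" "?x \<in> S2"
      using inner_polar_projection_pole[OF assms(1,2) ne False]
        inner_polar_projection_self[OF assms(1,2) ne False]
        sqrt_component_pos[OF assms(1,2) ne False]
        polar_projection_in_S2[OF assms(1,2) ne False] by auto
    then show ?thesis using iff[of ?x] by auto
  qed
qed

text \<open>
  The two endpoints of the semicircles are the unit multiples of \<open>cross3 g h\<close>, so a point is
  equidistant from them exactly when it is orthogonal to \<open>cross3 g h\<close>; in the plane of \<open>g\<close> and \<open>h\<close> the
  conditions on the midpoint leave only \<open>polar_projection g h\<close>.
\<close>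

lemma semicircle_center_eq_polar_projection:
  assumes "g \<in> S2" "h \<in> S2" "g \<noteq> h" "g \<noteq> - h"
  shows "semicircle_center (sph_disk g (pi / 2)) (sph_disk h (pi / 2)) = polar_projection g h"
proof -
  note pp = polar_projection_in_S2[OF assms] inner_polar_projection_pole[OF assms]
    inner_polar_projection_self[OF assms] sqrt_component_pos[OF assms]
  define m0 where "m0 = polar_projection g h"
  define n where "n = cross3 g h"
  have m0: "m0 \<bullet> m0 = 1" "g \<bullet> m0 = 0" "0 < h \<bullet> m0"
    using pp by (auto simp: m0_def norm_eq_1)
  have gn: "g \<bullet> n = 0" "h \<bullet> n = 0"
    by (simp_all add: n_def dot_cross_self)
  have m0n: "m0 \<bullet> n = 0"
    using gn by (simp add: m0_def inner_commute[of _ n] inner_polar_projection[OF assms])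
  have "(norm n)\<^sup>2 = 1 - (g \<bullet> h)\<^sup>2"
    using norm_cross_dot[of g h] assms(1,2) by (simp add: n_def)
  then have n0: "n \<noteq> 0" using square_inner_S2_less_1[OF assms] by auto
  have orth0: "d = 0" if d: "d \<bullet> g = 0" "d \<bullet> h = 0" "d \<bullet> n = 0" for d
  proof -
    have "cross3 d n = 0"
      unfolding n_def by (simp add: Lagrange d)
    then show ?thesis using norm_and_cross_eq_0[of d n] d n0 by auto
  qed
  define E where "E = {x \<in> S2. g \<bullet> x = 0} \<inter> {x \<in> S2. h \<bullet> x = 0}"
  have endpoint: "x = (x \<bullet> sgn n) *\<^sub>R sgn n" if "x \<in> E" for x
  proof -
    have "sgn n \<bullet> sgn n = 1" using sgn_in_S2[OF n0] by (simp add: norm_eq_1)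
    then have "(x - (x \<bullet> sgn n) *\<^sub>R sgn n) \<bullet> sgn n = 0"
      by (simp add: inner_diff)
    then have "(x - (x \<bullet> sgn n) *\<^sub>R sgn n) \<bullet> n = 0"
      using n0 by (simp add: inner_sgn)
    moreover have "(x - (x \<bullet> sgn n) *\<^sub>R sgn n) \<bullet> g = 0" "(x - (x \<bullet> sgn n) *\<^sub>R sgn n) \<bullet> h = 0"
      using that gn by (simp_all add: E_def inner_diff inner_commute[of _ g] inner_commute[of _ h] inner_sgn)
    ultimately have "x - (x \<bullet> sgn n) *\<^sub>R sgn n = 0" by (intro orth0)
    then show ?thesis by simp
  qed
  have E1: "sgn n \<in> E" "- sgn n \<in> E"
    using sgn_in_S2[OF n0] gn by (simp_all add: E_def inner_sgn)
  have equi: "(\<forall>e\<in>E. \<forall>e'\<in>E. sdist m e = sdist m e') \<longleftrightarrow> m \<bullet> n = 0" if "m \<in> S2" for m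
  proof
    assume "\<forall>e\<in>E. \<forall>e'\<in>E. sdist m e = sdist m e'"
    then have "sdist m (sgn n) = sdist m (- sgn n)" using E1 by blast
    then have "cos (sdist m (sgn n)) = cos (sdist m (- sgn n))" by simp
    then have "m \<bullet> sgn n = m \<bullet> (- sgn n)"
      using that E1 unfolding E_def by (simp add: cos_sdist)
    then show "m \<bullet> n = 0" using n0 by (simp add: inner_sgn)
  next
    assume "m \<bullet> n = 0"
    then have "m \<bullet> e = 0" if "e \<in> E" for e
      by (subst endpoint[OF that]) (simp add: inner_sgn)
    then show "\<forall>e\<in>E. \<forall>e'\<in>E. sdist m e = sdist m e'" by (simp add: sdist_def)
  qed
  have iff: "m \<in> {x \<in> S2. g \<bullet> x = 0} \<inter> {x \<in> S2. 0 \<le> h \<bullet> x} \<and>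
      (\<forall>e\<in>E. \<forall>e'\<in>E. sdist m e = sdist m e') \<longleftrightarrow> m = m0" for m
  proof
    assume m: "m \<in> {x \<in> S2. g \<bullet> x = 0} \<inter> {x \<in> S2. 0 \<le> h \<bullet> x} \<and>
      (\<forall>e\<in>E. \<forall>e'\<in>E. sdist m e = sdist m e')"
    then have mS: "m \<in> S2" and gm: "g \<bullet> m = 0" and hm: "0 \<le> h \<bullet> m" by blast+
    have mn: "m \<bullet> n = 0" using m equi[OF mS] by blast
    define d where "d = m - (m \<bullet> m0) *\<^sub>R m0"
    have dg: "d \<bullet> g = 0" using gm m0 by (simp add: d_def inner_diff inner_commute)
    have dm0: "d \<bullet> m0 = 0" using m0 by (simp add: d_def inner_diff)
    have "d \<bullet> n = 0" using mn m0n by (simp add: d_def inner_diff)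
    moreover have "d \<bullet> h = 0"
      using dm0 dg pp(4) unfolding m0_def inner_polar_projection[OF assms] by auto
    ultimately have "d = 0" using orth0 dg by blast
    then have mm: "m = (m \<bullet> m0) *\<^sub>R m0" by (simp add: d_def)
    have "h \<bullet> m = (m \<bullet> m0) * (h \<bullet> m0)"
      using arg_cong[OF mm, of "inner h"] by simp
    then have "0 \<le> (m \<bullet> m0) * (h \<bullet> m0)"
      using hm by simp
    then have nonneg: "0 \<le> m \<bullet> m0" using m0(3) by (simp add: zero_le_mult_iff)
    have "norm m = \<bar>m \<bullet> m0\<bar> * norm m0"
      using arg_cong[OF mm, of norm] by simp
    then have "m \<bullet> m0 = 1"
      using mS nonneg pp(1) by (simp add: m0_def)
    then show "m = m0" using mm by simp
  next
    assume m: "m = m0"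
    then have "m \<in> S2" "m \<bullet> n = 0" "g \<bullet> m = 0" "0 \<le> h \<bullet> m"
      using m0 m0n by (auto simp: norm_eq_1)
    then show "m \<in> {x \<in> S2. g \<bullet> x = 0} \<inter> {x \<in> S2. 0 \<le> h \<bullet> x} \<and>
      (\<forall>e\<in>E. \<forall>e'\<in>E. sdist m e = sdist m e')"
      using equi[of m] by blast
  qed
  have "(THE m. m \<in> {x \<in> S2. g \<bullet> x = 0} \<inter> {x \<in> S2. 0 \<le> h \<bullet> x} \<and>
      (\<forall>e\<in>E. \<forall>e'\<in>E. sdist m e = sdist m e')) = m0"
    unfolding iff by (rule the_eq_trivial)
  then show ?thesis
    unfolding semicircle_center_def sph_boundary_hemisphere[OF assms(1)]
      sph_boundary_hemisphere[OF assms(2)] unfolding hemisphere_eq_halfspace[OF assms(2)] E_def m0_def .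
qed

lemma lune_thickness_eq:
  assumes "g \<in> S2" "h \<in> S2" "g \<noteq> h" "g \<noteq> - h"
  shows "lune_thickness (sph_disk g (pi / 2)) (sph_disk h (pi / 2)) = pi - sdist g h"
proof -
  have assms': "h \<in> S2" "g \<in> S2" "h \<noteq> g" "h \<noteq> - g" using assms by auto
  have pos: "0 < 1 - (g \<bullet> h)\<^sup>2" using square_inner_S2_less_1[OF assms] by simp
  have "polar_projection h g \<bullet> polar_projection g h
      = (h \<bullet> polar_projection h g - (g \<bullet> h) * (g \<bullet> polar_projection h g)) / sqrt (1 - (g \<bullet> h)\<^sup>2)"
    by (subst inner_polar_projection[OF assms]) (simp add: inner_commute)
  also have "\<dots> = - (g \<bullet> h)"
    using pos inner_polar_projection_pole[OF assms'] inner_polar_projection_self[OF assms']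
    by (simp add: inner_commute[of h g])
  finally have "sdist (polar_projection g h) (polar_projection h g) = arccos (- (g \<bullet> h))"
    by (simp add: sdist_def inner_commute)
  then show ?thesis
    unfolding lune_thickness_def semicircle_center_eq_polar_projection[OF assms]
      semicircle_center_eq_polar_projection[OF assms']
    using arccos_minus inner_S2_bounds[OF assms(1,2)] by (simp add: sdist_def)
qed

section \<open>Supporting hemispheres of a convex body\<close>

text \<open>For a convex body these points form the boundary of its polar body in the sphere.\<close>

definition support_centers :: "(real^3) set \<Rightarrow> (real^3) set" where
  "support_centers W = {k \<in> S2. (\<forall>x\<in>W. 0 \<le> k \<bullet> x) \<and> (\<exists>y\<in>W. k \<bullet> y = 0)}"

lemma support_centersI:
  assumes "v \<noteq> 0" "\<And>x. x \<in> W \<Longrightarrow> 0 \<le> v \<bullet> x" "y \<in> W" "v \<bullet> y = 0"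
  shows "sgn v \<in> support_centers W"
  unfolding support_centers_def
  using assms sgn_in_S2[of v] by (auto simp: inner_commute[of "sgn v"] inner_commute[of v] inner_sgn)

text \<open>
  Interior points of \<open>W\<close> are interior points of every hemisphere containing \<open>W\<close>. Hence a point of
  \<open>W\<close> on the boundary circle of such a hemisphere is a boundary point of \<open>W\<close>.
\<close>

lemma interior_subset_open_hemisphere:
  assumes "k \<in> S2" "W \<subseteq> S2" "\<And>x. x \<in> W \<Longrightarrow> 0 \<le> k \<bullet> x"
    and "x \<in> (top_of_set S2) interior_of W"
  shows "0 < k \<bullet> x"
proof -
  have "W \<subseteq> {x \<in> S2. 0 \<le> k \<bullet> x}" using assms by auto
  then show ?thesis
    using interior_of_mono[of W "{x \<in> S2. 0 \<le> k \<bullet> x}" "top_of_set S2"]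
      interior_of_hemisphere[OF assms(1)] assms(4) by blast
qed

lemma supports_iff_support_centers:
  assumes "closedin (top_of_set S2) W"
  shows "supports K W \<longleftrightarrow> (\<exists>k\<in>support_centers W. K = sph_disk k (pi / 2))"
proof -
  have sub: "W \<subseteq> S2" using closedin_subset[OF assms] by simp
  have "W \<subseteq> sph_disk k (pi / 2) \<and> sph_boundary W \<inter> sph_boundary (sph_disk k (pi / 2)) \<noteq> {} \<longleftrightarrow>
      k \<in> support_centers W" if k: "k \<in> S2" for k
  proof -
    have fr: "sph_boundary W = W - (top_of_set S2) interior_of W"
      by (simp add: frontier_of_def closure_of_closedin[OF assms])
    have "W \<subseteq> {x \<in> S2. 0 \<le> k \<bullet> x} \<longleftrightarrow> (\<forall>x\<in>W. 0 \<le> k \<bullet> x)"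
      using sub by auto
    moreover have "(W - (top_of_set S2) interior_of W) \<inter> {x \<in> S2. k \<bullet> x = 0} \<noteq> {} \<longleftrightarrow>
        (\<exists>y\<in>W. k \<bullet> y = 0)" if "\<forall>x\<in>W. 0 \<le> k \<bullet> x"
    proof -
      have "k \<bullet> y \<noteq> 0" if "y \<in> (top_of_set S2) interior_of W" for y
        using interior_subset_open_hemisphere[OF k sub _ that] \<open>\<forall>x\<in>W. 0 \<le> k \<bullet> x\<close>
        by (metis less_irrefl)
      then show ?thesis using sub by blast
    qed
    ultimately show ?thesis
      unfolding hemisphere_eq_halfspace[OF k] sph_boundary_hemisphere[OF k, unfolded hemisphere_eq_halfspace[OF k]] fr
        support_centers_def using k by blast
  qed
  then show ?thesis
    unfolding supports_def hemisphere_def support_centers_def by blast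
qed

lemma compact_support_centers:
  assumes "compact W"
  shows "compact (support_centers W)"
proof -
  have c: "compact ((S2 \<times> W) \<inter> {p. fst p \<bullet> snd p = 0})"
    by (intro compact_Int_closed compact_Times compact_sphere assms closed_Collect_eq continuous_intros)
  have cl: "closed (\<Inter>x\<in>W. {k. 0 \<le> k \<bullet> x})"
    by (intro closed_INT ballI closed_Collect_le continuous_intros)
  have "support_centers W = fst ` ((S2 \<times> W) \<inter> {p. fst p \<bullet> snd p = 0}) \<inter> (\<Inter>x\<in>W. {k. 0 \<le> k \<bullet> x})"
    unfolding support_centers_def by force
  also have "compact \<dots>"
    by (intro compact_Int_closed[OF _ cl] compact_continuous_image[OF _ c] continuous_intros)
  finally show ?thesis .
qed

text \<open>
  With \<open>u = a \<bullet> x\<close> and \<open>v = x \<bullet> b\<close> for the normalized combination \<open>x\<close>, a computation gives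
  \<open>u v - sqrt (1 - u\<^sup>2) sqrt (1 - v\<^sup>2) = a \<bullet> b\<close>, the addition formula for the cosine of the two
  distances; \<open>0 \<le> u + v\<close> ensures that their sum does not exceed \<open>\<pi>\<close>.
\<close>

lemma sgn_combination_in_sph_arc:
  assumes ab: "a \<in> S2" "b \<in> S2" "b \<noteq> - a" and st: "0 < s" "0 < t"
  shows "s *\<^sub>R a + t *\<^sub>R b \<noteq> 0" "sgn (s *\<^sub>R a + t *\<^sub>R b) \<in> sph_arc a b"
proof -
  define c where "c = a \<bullet> b"
  define n where "n = norm (s *\<^sub>R a + t *\<^sub>R b)"
  define x where "x = sgn (s *\<^sub>R a + t *\<^sub>R b)"
  have aa: "a \<bullet> a = 1" "b \<bullet> b = 1" using ab by (auto simp: norm_eq_1)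
  have c: "-1 < c" "c \<le> 1"
    using inner_S2_bounds[OF ab(1,2)] inner_S2_eq_minus_1_iff[of b a] ab
    by (auto simp: c_def inner_commute less_le)
  have nn: "n\<^sup>2 = s\<^sup>2 + t\<^sup>2 + 2 * s * t * c"
    unfolding n_def c_def power2_norm_eq_inner using aa
    by (simp add: inner_add inner_commute power2_eq_square algebra_simps)
  also have "\<dots> = (s - t)\<^sup>2 + 2 * s * t * (1 + c)"
    by (simp add: power2_eq_square algebra_simps)
  also have "\<dots> > 0"
    using c st by (intro add_nonneg_pos) auto
  finally have "n \<noteq> 0" by auto
  then have n: "0 < n" by (simp add: n_def)
  then show nz: "s *\<^sub>R a + t *\<^sub>R b \<noteq> 0" by (auto simp: n_def)
  have xS: "x \<in> S2" unfolding x_def by (rule sgn_in_S2[OF nz])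
  have u: "a \<bullet> x = (s + t * c) / n" and v: "x \<bullet> b = (s * c + t) / n"
    unfolding x_def inner_commute[of _ b] inner_sgn n_def[symmetric] using aa
    by (simp_all add: inner_add c_def inner_commute)
  have "1 - (a \<bullet> x)\<^sup>2 = (t / n)\<^sup>2 * (1 - c\<^sup>2)"
  proof -
    have "n\<^sup>2 - (s + t * c)\<^sup>2 = t\<^sup>2 * (1 - c\<^sup>2)"
      unfolding nn by (simp add: power2_eq_square algebra_simps)
    then show ?thesis using n by (simp add: u field_simps)
  qed
  moreover have "1 - (x \<bullet> b)\<^sup>2 = (s / n)\<^sup>2 * (1 - c\<^sup>2)"
  proof -
    have "n\<^sup>2 - (s * c + t)\<^sup>2 = s\<^sup>2 * (1 - c\<^sup>2)"
      unfolding nn by (simp add: power2_eq_square algebra_simps)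
    then show ?thesis using n by (simp add: v field_simps)
  qed
  ultimately have sines: "sin (sdist a x) = t / n * sqrt (1 - c\<^sup>2)" "sin (sdist x b) = s / n * sqrt (1 - c\<^sup>2)"
    using abs_inner_S2_le_1[OF ab(1) xS] abs_inner_S2_le_1[OF xS ab(2)] n st
    by (simp_all add: sdist_def sin_arccos_abs real_sqrt_mult)
  have c2: "c\<^sup>2 \<le> 1" using c by (simp add: abs_square_le_1)
  have "sin (sdist a x) * sin (sdist x b) = s * t * (1 - c\<^sup>2) / n\<^sup>2"
    using c2 unfolding sines by (simp add: power2_eq_square)
  then have "cos (sdist a x + sdist x b) = ((s + t * c) * (s * c + t) - s * t * (1 - c\<^sup>2)) / n\<^sup>2"
    using ab xS by (simp add: cos_add cos_sdist u v diff_divide_distrib power2_eq_square)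
  also have "(s + t * c) * (s * c + t) - s * t * (1 - c\<^sup>2) = c * n\<^sup>2"
    unfolding nn by (simp add: power2_eq_square algebra_simps)
  finally have cos: "cos (sdist a x + sdist x b) = c" using n by simp
  have "a \<bullet> x + x \<bullet> b = (s + t) * (1 + c) / n"
    unfolding u v by (simp add: add_divide_distrib[symmetric] algebra_simps)
  then have "0 \<le> a \<bullet> x + x \<bullet> b" using n st c by simp
  then have "sdist a x + sdist x b \<le> pi"
    unfolding sdist_def
    using abs_inner_S2_le_1[OF ab(1) xS] abs_inner_S2_le_1[OF xS ab(2)] by (intro arccos_add_le_pi)
  then have "sdist a b = sdist a x + sdist x b"
    using arccos_cos[of "sdist a x + sdist x b"] sdist_bounds[OF ab(1) xS] sdist_bounds[OF xS ab(2)]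
    by (simp add: cos sdist_def[of a b] c_def[symmetric])
  moreover have "x \<in> span {a, b}"
    unfolding x_def sgn_div_norm by (intro span_mul span_add) (auto intro: span_base)
  ultimately show "sgn (s *\<^sub>R a + t *\<^sub>R b) \<in> sph_arc a b"
    using xS unfolding sph_arc_def x_def by auto
qed

text \<open>
  By the previous lemma the open cone over \<open>W\<close> is convex, hence it contains the convex hull of \<open>W\<close>,
  which therefore avoids the origin.
\<close>

lemma sph_convex_imp_0_notin_hull:
  assumes "sph_convex W"
  shows "0 \<notin> convex hull W"
proof -
  have W: "W \<subseteq> S2" "\<And>a. a \<in> W \<Longrightarrow> - a \<notin> W" "\<And>a b. a \<in> W \<Longrightarrow> b \<in> W \<Longrightarrow> sph_arc a b \<subseteq> W"
    using assms by (auto simp: sph_convex_def)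
  define P where "P = {r *\<^sub>R x | r x. 0 < r \<and> x \<in> W}"
  have "W \<subseteq> P"
  proof
    fix x assume "x \<in> W"
    then show "x \<in> P" unfolding P_def by (intro CollectI exI[of _ 1] exI[of _ x]) auto
  qed
  moreover have "convex P"
    unfolding convex_alt
  proof (intro ballI allI impI)
    fix y z and u :: real
    assume "y \<in> P" "z \<in> P" and u: "0 \<le> u \<and> u \<le> 1"
    then obtain r a q b where y: "y = r *\<^sub>R a" "0 < r" "a \<in> W" and z: "z = q *\<^sub>R b" "0 < q" "b \<in> W"
      by (auto simp: P_def)
    show "(1 - u) *\<^sub>R y + u *\<^sub>R z \<in> P"
    proof (cases "u = 0 \<or> u = 1")
      case True
      then show ?thesis using \<open>y \<in> P\<close> \<open>z \<in> P\<close> by auto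
    next
      case False
      let ?v = "((1 - u) * r) *\<^sub>R a + (u * q) *\<^sub>R b"
      have "b \<noteq> - a" using W y z by auto
      moreover have "0 < (1 - u) * r" "0 < u * q" using False u y z by auto
      ultimately have "?v \<noteq> 0" "sgn ?v \<in> W"
        using sgn_combination_in_sph_arc[of a b "(1 - u) * r" "u * q"] W y z by blast+
      then have "norm ?v *\<^sub>R sgn ?v \<in> P" unfolding P_def by force
      then show ?thesis using \<open>?v \<noteq> 0\<close> by (simp add: y z sgn_div_norm)
    qed
  qed
  ultimately have "convex hull W \<subseteq> P" by (rule hull_minimal)
  moreover have "0 \<notin> P" using W by (auto simp: P_def)
  ultimately show ?thesis by blast
qed

lemma ex_strictly_positive_functional:
  assumes "compact W" "sph_convex W"
  obtains p where "\<And>x. x \<in> W \<Longrightarrow> 0 < p \<bullet> x"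
proof -
  have "convex (convex hull W)" "closed (convex hull W)"
    using assms(1) by (auto intro: compact_imp_closed compact_convex_hull)
  then obtain p \<beta> where p: "0 < \<beta>" "\<forall>x\<in>convex hull W. \<beta> < p \<bullet> x"
    using separating_hyperplane_closed_0 sph_convex_imp_0_notin_hull[OF assms(2)] by metis
  then show thesis
    using that[of p] hull_subset[of W convex] by force
qed

text \<open>
  In the pencil \<open>M p - v\<close>, where \<open>p\<close> is positive on \<open>W\<close>, the supporting hemisphere belongs to the
  maximum \<open>M\<close> of \<open>v \<bullet> x / p \<bullet> x\<close> on \<open>W\<close>.
\<close>

lemma ex_support_center_in_pencil:
  assumes "compact W" "W \<noteq> {}" and p: "\<And>x. x \<in> W \<Longrightarrow> 0 < p \<bullet> x" and v: "\<And>r. v \<noteq> r *\<^sub>R p"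
  obtains M where "M *\<^sub>R p - v \<noteq> 0" "sgn (M *\<^sub>R p - v) \<in> support_centers W"
    "\<forall>x\<in>W. v \<bullet> x \<le> M * (p \<bullet> x)"
proof -
  have "continuous_on W (\<lambda>x. (v \<bullet> x) / (p \<bullet> x))"
    using p by (intro continuous_intros) force
  then obtain x where x: "x \<in> W" "\<And>y. y \<in> W \<Longrightarrow> (v \<bullet> y) / (p \<bullet> y) \<le> (v \<bullet> x) / (p \<bullet> x)"
    using continuous_attains_sup[OF assms(1,2)] by blast
  define M where "M = (v \<bullet> x) / (p \<bullet> x)"
  have max: "v \<bullet> y \<le> M * (p \<bullet> y)" if "y \<in> W" for y
    using x(2)[OF that] p[OF that] by (simp add: M_def[symmetric] pos_divide_le_eq)
  have nz: "M *\<^sub>R p - v \<noteq> 0" using v[of M] by auto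
  moreover have "sgn (M *\<^sub>R p - v) \<in> support_centers W"
  proof (rule support_centersI[OF nz _ x(1)])
    show "0 \<le> (M *\<^sub>R p - v) \<bullet> y" if "y \<in> W" for y
      using max[OF that] by (simp add: inner_diff)
    show "(M *\<^sub>R p - v) \<bullet> x = 0"
      using p[OF x(1)] by (simp add: inner_diff M_def)
  qed
  ultimately show thesis using that max by blast
qed

lemma support_centers_nonempty:
  assumes "compact W" "W \<noteq> {}" "sph_convex W"
  shows "support_centers W \<noteq> {}"
proof -
  obtain p where p: "\<And>x. x \<in> W \<Longrightarrow> 0 < p \<bullet> x"
    using ex_strictly_positive_functional assms(1,3) by blast
  obtain v where v: "v \<noteq> 0" "orthogonal p v"
    using orthogonal_to_vector_exists[of p] by auto
  have vp: "v \<noteq> r *\<^sub>R p" for r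
    using v by (auto simp: orthogonal_def)
  show ?thesis
    by (rule ex_support_center_in_pencil[OF assms(1,2) p vp]) auto
qed

text \<open>
  At a point \<open>y\<close> of \<open>W\<close> with \<open>k \<bullet> y = 0\<close> the second center is positive, which separates it from
  \<open>k\<close> and \<open>- k\<close>.
\<close>

lemma ex_lune_partner:
  assumes "compact W" "sph_convex W" "k \<in> support_centers W"
    and x0: "x0 \<in> W" "0 < k \<bullet> x0"
  obtains k' where "k' \<in> support_centers W" "k \<noteq> k'" "k \<noteq> - k'"
proof -
  obtain y where y: "y \<in> W" "k \<bullet> y = 0"
    using assms(3) by (auto simp: support_centers_def)
  obtain p where p: "\<And>x. x \<in> W \<Longrightarrow> 0 < p \<bullet> x"
    using ex_strictly_positive_functional assms(1,2) by blast
  have ne: "W \<noteq> {}" using y by auto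
  have kp: "k \<noteq> r *\<^sub>R p" for r
    using y x0 p[OF y(1)] by auto
  obtain M where M: "M *\<^sub>R p - k \<noteq> 0" "sgn (M *\<^sub>R p - k) \<in> support_centers W"
    "\<forall>x\<in>W. k \<bullet> x \<le> M * (p \<bullet> x)"
    by (rule ex_support_center_in_pencil[OF assms(1) ne, of p k]) (use p kp that in blast)+
  have "0 < M * (p \<bullet> x0)" using M(3) x0 by (meson less_le_trans)
  then have "0 < M" using p[OF x0(1)] by (simp add: zero_less_mult_iff)
  then have "0 < (M *\<^sub>R p - k) \<bullet> y" using p[OF y(1)] y(2) by (simp add: inner_diff)
  then have pos: "0 < sgn (M *\<^sub>R p - k) \<bullet> y"
    using M(1) by (simp add: sgn_div_norm)
  show thesis
  proof (rule that[OF M(2)])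
    have "k \<bullet> y \<noteq> sgn (M *\<^sub>R p - k) \<bullet> y" "k \<bullet> y \<noteq> - sgn (M *\<^sub>R p - k) \<bullet> y"
      using pos y(2) by auto
    then show "k \<noteq> sgn (M *\<^sub>R p - k)" "k \<noteq> - sgn (M *\<^sub>R p - k)"
      by (blast dest: arg_cong[of _ _ "\<lambda>x. x \<bullet> y"])+
  qed
qed

section \<open>A spherical Jung theorem\<close>

text \<open>
  Jung's theorem on the sphere. The center is the direction of the point \<open>z\<close> of the convex hull of
  \<open>A\<close> that is nearest to the origin. Minimality gives \<open>|z|\<^sup>2 \<le> z \<bullet> a\<close> on \<open>A\<close>, so \<open>z\<close> lies in the
  convex hull of those points of \<open>A\<close> with equality; these lie in a plane, and by Caratheodory's theorem
  three of them suffice. If \<open>z = \<Sum> u\<^sub>i a\<^sub>i\<close>, then expanding the square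
  gives \<open>|z|\<^sup>2 \<ge> q + (1 - q) \<Sum> u\<^sub>i\<^sup>2 \<ge> q + (1 - q) / 3\<close>.
\<close>

lemma spherical_jung:
  assumes A: "compact A" "A \<noteq> {}" "A \<subseteq> S2" "0 \<notin> convex hull A"
    and q: "q \<le> 1" "\<And>a b. a \<in> A \<Longrightarrow> b \<in> A \<Longrightarrow> q \<le> a \<bullet> b"
  obtains z where "z \<in> convex hull A" "z \<noteq> 0" "(1 + 2 * q) / 3 \<le> (norm z)\<^sup>2"
    "\<And>a. a \<in> A \<Longrightarrow> (norm z)\<^sup>2 \<le> z \<bullet> a"
proof -
  let ?H = "convex hull A"
  have H: "convex ?H" "closed ?H" "?H \<noteq> {}"
    using A by (auto intro: compact_imp_closed compact_convex_hull)
  define z where "z = closest_point ?H 0"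
  have z: "z \<in> ?H" unfolding z_def by (rule closest_point_in_set[OF H(2,3)])
  have min: "(norm z)\<^sup>2 \<le> z \<bullet> a" if "a \<in> ?H" for a
    using closest_point_dot[OF H(1,2) that, of 0]
    by (simp add: z_def[symmetric] inner_diff power2_norm_eq_inner inner_commute)
  have "(?H \<inter> {x. z \<bullet> x = (norm z)\<^sup>2}) face_of ?H"
    using min by (intro face_of_Int_supporting_hyperplane_ge H) auto
  then obtain A' where A': "A' \<subseteq> A" "?H \<inter> {x. z \<bullet> x = (norm z)\<^sup>2} = convex hull A'"
    using face_of_convex_hull_subset[OF A(1)] by metis
  have "z \<noteq> 0" using z A(4) by auto
  have "A' \<subseteq> {x. z \<bullet> x = (norm z)\<^sup>2}"
    using A'(2) hull_subset[of A' convex] by blast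
  then have dim: "aff_dim A' \<le> 2"
    using aff_dim_subset[of A' "{x. z \<bullet> x = (norm z)\<^sup>2}"] aff_dim_hyperplane[OF \<open>z \<noteq> 0\<close>] by simp
  have "z \<in> convex hull A'"
    using z A'(2) by (auto simp: power2_norm_eq_inner)
  then obtain S u where S: "finite S" "S \<subseteq> A'" "card S \<le> aff_dim A' + 1"
    and u: "\<forall>x\<in>S. 0 \<le> u x" "sum u S = 1" "(\<Sum>v\<in>S. u v *\<^sub>R v) = z"
    unfolding convex_hull_caratheodory_aff_dim[of A'] by auto
  have "card S \<le> 3" using S(3) dim by linarith
  have "1 \<le> (\<Sum>x\<in>S. (u x)\<^sup>2) * card S"
    using sum_squared_le_sum_of_squares[of u S] u(2) by simp
  also have "\<dots> \<le> (\<Sum>x\<in>S. (u x)\<^sup>2) * 3"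
    using \<open>card S \<le> 3\<close> by (intro mult_left_mono sum_nonneg) auto
  finally have sq: "1 / 3 \<le> (\<Sum>x\<in>S. (u x)\<^sup>2)" by simp
  \<comment> \<open>Off the diagonal the inner products are at least \<open>q\<close>, on it they equal 1.\<close>
  have entry: "q * (u x * u y) + (if x = y then (1 - q) * (u x * u y) else 0) \<le> u x * u y * (x \<bullet> y)"
    if xy: "x \<in> S" "y \<in> S" for x y
  proof -
    have in_A: "x \<in> A" "y \<in> A" using xy S A' by auto
    have "0 \<le> u x * u y" using u(1) xy by simp
    then have "u x * u y * q \<le> u x * u y * (x \<bullet> y)"
      by (intro mult_left_mono q in_A)
    moreover have "x \<bullet> x = 1" using in_A A(3) by (auto simp: norm_eq_1[symmetric])
    ultimately show ?thesis by (auto simp: algebra_simps)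
  qed
  have "q + (1 - q) * (\<Sum>x\<in>S. (u x)\<^sup>2)
      = (\<Sum>x\<in>S. \<Sum>y\<in>S. q * (u x * u y) + (if x = y then (1 - q) * (u x * u y) else 0))"
  proof -
    have "(\<Sum>x\<in>S. \<Sum>y\<in>S. q * (u x * u y)) = q * (sum u S * sum u S)"
      unfolding sum_product by (simp add: sum_distrib_left)
    then show ?thesis
      using S(1) u(2) by (simp add: sum.distrib sum.delta sum_distrib_left power2_eq_square)
  qed
  also have "\<dots> \<le> (\<Sum>x\<in>S. \<Sum>y\<in>S. u x * u y * (x \<bullet> y))"
    by (intro sum_mono entry)
  also have "\<dots> = z \<bullet> z"
    unfolding u(3)[symmetric] by (simp add: inner_sum_left inner_sum_right sum_distrib_left mult_ac inner_commute)
  finally have "q + (1 - q) * (\<Sum>x\<in>S. (u x)\<^sup>2) \<le> (norm z)\<^sup>2"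
    by (simp add: power2_norm_eq_inner)
  moreover have "(1 - q) * (1 / 3) \<le> (1 - q) * (\<Sum>x\<in>S. (u x)\<^sup>2)"
    using q(1) sq by (intro mult_left_mono) auto
  ultimately have "(1 + 2 * q) / 3 \<le> (norm z)\<^sup>2" by (simp add: field_simps)
  then show thesis
    using that z \<open>z \<noteq> 0\<close> min hull_subset[of A convex] by blast
qed

text \<open>The radius is the one for which the previous bound reads \<open>cos\<^sup>2 R \<le> |z|\<^sup>2\<close>.\<close>

corollary spherical_jung_disk:
  assumes A: "compact A" "A \<noteq> {}" "A \<subseteq> S2" "0 \<notin> convex hull A"
    and d: "0 \<le> d" "d \<le> 2 * pi / 3" "\<And>a b. a \<in> A \<Longrightarrow> b \<in> A \<Longrightarrow> sdist a b \<le> d"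
  obtains z where "z \<in> convex hull A" "z \<noteq> 0"
    "\<And>a. a \<in> A \<Longrightarrow> sdist (sgn z) a \<le> arcsin (2 * sqrt 3 / 3 * sin (d / 2))"
proof -
  define s where "s = 2 * sqrt 3 / 3 * sin (d / 2)"
  have "0 \<le> sin (d / 2)" using d by (intro sin_ge_zero) auto
  then have s0: "0 \<le> s" by (simp add: s_def)
  have "sin (d / 2) \<le> sin (pi / 3)" using d by (intro sin_monotone_2pi_le) auto
  then have "s \<le> 2 * sqrt 3 / 3 * (sqrt 3 / 2)"
    unfolding s_def sin_60 by (intro mult_left_mono) auto
  then have s1: "s \<le> 1" by simp
  have "s\<^sup>2 = 4 / 3 * (sin (d / 2))\<^sup>2"
    by (simp add: s_def power_mult_distrib power_divide)
  moreover have "cos d = 1 - 2 * (sin (d / 2))\<^sup>2"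
    using cos_double_sin[of "d / 2"] by simp
  ultimately have s_cos: "1 - s\<^sup>2 = (1 + 2 * cos d) / 3" by (simp add: field_simps)
  have "cos d \<le> a \<bullet> b" if "a \<in> A" "b \<in> A" for a b
  proof -
    have "a \<in> S2" "b \<in> S2" using that A(3) by auto
    then show ?thesis
      using cos_monotone_0_pi_le[OF _ d(3)[OF that]] d(2) sdist_bounds[of a b] cos_sdist[of a b] pi_gt_zero
      by simp
  qed
  then obtain z where z: "z \<in> convex hull A" "z \<noteq> 0" "(1 + 2 * cos d) / 3 \<le> (norm z)\<^sup>2"
    "\<And>a. a \<in> A \<Longrightarrow> (norm z)\<^sup>2 \<le> z \<bullet> a"
    using spherical_jung[OF A cos_le_one] by metis
  have "sqrt (1 - s\<^sup>2) \<le> norm z"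
    using z(3) by (intro real_le_lsqrt) (auto simp: s_cos)
  then have cos_R: "cos (arcsin s) \<le> norm z" using s0 s1 by (simp add: cos_arcsin)
  have "sdist (sgn z) a \<le> arcsin s" if a: "a \<in> A" for a
  proof (rule sdist_le_cos)
    have "norm z \<le> (z \<bullet> a) / norm z"
      using z(4)[OF a] z(2) by (simp add: pos_le_divide_eq power2_eq_square)
    then show "cos (arcsin s) \<le> sgn z \<bullet> a"
      using cos_R by (simp add: inner_commute[of _ a] inner_sgn)
    show "0 \<le> arcsin s" using s0 s1 by (simp add: arcsin_nonneg)
    show "arcsin s \<le> pi" using arcsin_ubound[of s] s0 s1 pi_gt_zero by linarith
  qed (use a A z sgn_in_S2 in auto)
  then show thesis using that z(1,2) unfolding s_def by blast
qed

section \<open>Bodies of constant width\<close>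

lemma sph_width_eq:
  assumes "closedin (top_of_set S2) W" "k \<in> support_centers W"
  shows "sph_width (sph_disk k (pi / 2)) W =
    Inf {pi - sdist k k' | k'. k' \<in> support_centers W \<and> k \<noteq> k' \<and> k \<noteq> - k'}"
proof -
  let ?H = "\<lambda>c. sph_disk c (pi / 2)"
  have kS: "k \<in> S2" using assms(2) by (simp add: support_centers_def)
  have lune: "lune_pair (?H k) (?H k') \<longleftrightarrow> k \<noteq> k' \<and> k \<noteq> - k'" if "k' \<in> S2" for k'
    unfolding lune_pair_def using sph_disk_half_pi_inj kS that by metis
  have S: "k' \<in> S2" if "k' \<in> support_centers W" for k'
    using that by (simp add: support_centers_def)
  have "{lune_thickness (?H k) K' | K'. supports K' W \<and> lune_pair (?H k) K'} =
      {lune_thickness (?H k) (?H k') | k'. k' \<in> support_centers W \<and> lune_pair (?H k) (?H k')}"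
    unfolding supports_iff_support_centers[OF assms(1)] by blast
  also have "\<dots> = {pi - sdist k k' | k'. k' \<in> support_centers W \<and> k \<noteq> k' \<and> k \<noteq> - k'}"
  proof (intro Collect_cong ex_cong1)
    fix v k'
    show "v = lune_thickness (?H k) (?H k') \<and> k' \<in> support_centers W \<and> lune_pair (?H k) (?H k')
        \<longleftrightarrow> v = pi - sdist k k' \<and> k' \<in> support_centers W \<and> k \<noteq> k' \<and> k \<noteq> - k'"
    proof (cases "k' \<in> support_centers W \<and> k \<noteq> k' \<and> k \<noteq> - k'")
      case True
      then show ?thesis using lune[OF S] lune_thickness_eq[OF kS S, of k'] by simp
    next
      case False
      then show ?thesis using lune[OF S, of k'] by blast
    qed
  qed
  finally show ?thesis unfolding sph_width_def by simp
qed

lemma compact_sph_convex_body: "sph_convex_body W \<Longrightarrow> compact W"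
  unfolding sph_convex_body_def by (metis closedin_compact compact_sphere)

text \<open>
  Any interior point of \<open>W\<close> serves. It shows that no two supporting hemispheres are opposite and that
  the convex hull of their centers avoids the origin.
\<close>

lemma ex_common_positive_point:
  assumes "sph_convex_body W"
  obtains x where "x \<in> W" "\<And>k. k \<in> support_centers W \<Longrightarrow> 0 < k \<bullet> x"
proof -
  obtain x where x: "x \<in> (top_of_set S2) interior_of W"
    using assms by (auto simp: sph_convex_body_def)
  have sub: "W \<subseteq> S2" using assms by (simp add: sph_convex_body_def sph_convex_def)
  have "x \<in> W" using subsetD[OF interior_of_subset x] .
  moreover have "0 < k \<bullet> x" if "k \<in> support_centers W" for k
    using interior_subset_open_hemisphere[OF _ sub _ x, of k] that
    by (auto simp: support_centers_def)
  ultimately show thesis using that by blast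
qed

text \<open>
  Constant width \<open>w\<close> of \<open>W\<close> says that the centers of the supporting hemispheres form a set of
  constant diameter \<open>\<pi> - w\<close>: each of them has others at distance arbitrarily close to \<open>\<pi> - w\<close>, and
  none farther away.
\<close>

lemma
  assumes W: "sph_constant_width W" and k: "k \<in> support_centers W"
  shows sdist_support_centers_le:
      "k' \<in> support_centers W \<Longrightarrow> sdist k k' \<le> pi - sph_thickness W"
    and ex_far_support_center:
      "e < pi - sph_thickness W \<Longrightarrow> \<exists>k'\<in>support_centers W. e < sdist k k'"
proof -
  have body: "sph_convex_body W" using W by (simp add: sph_constant_width_def)
  then have cl: "closedin (top_of_set S2) W" and conv: "sph_convex W"
    by (auto simp: sph_convex_body_def)
  have comp: "compact W" by (rule compact_sph_convex_body[OF body])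
  obtain x0 where x0: "x0 \<in> W" "\<And>k. k \<in> support_centers W \<Longrightarrow> 0 < k \<bullet> x0"
    using ex_common_positive_point[OF body] by metis
  have S: "k \<in> S2" if "k \<in> support_centers W" for k
    using that by (simp add: support_centers_def)
  let ?D = "{pi - sdist k k' | k'. k' \<in> support_centers W \<and> k \<noteq> k' \<and> k \<noteq> - k'}"
  have sup: "supports (sph_disk k (pi / 2)) W"
    using k supports_iff_support_centers[OF cl] by blast
  then have "{sph_width K W | K. supports K W} = {sph_width (sph_disk k (pi / 2)) W}"
    using W unfolding sph_constant_width_def by blast
  then have thick: "sph_thickness W = Inf ?D"
    unfolding sph_thickness_def by (simp add: sph_width_eq[OF cl k])
  have bdd: "bdd_below ?D"
    using sdist_bounds(2)[OF S[OF k] S] by (intro bdd_belowI[of _ 0]) auto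
  obtain k1 where k1: "k1 \<in> support_centers W" "k \<noteq> k1" "k \<noteq> - k1"
    using ex_lune_partner[OF comp conv k x0(1) x0(2)[OF k]] by blast
  then have ne: "?D \<noteq> {}" by blast
  have le: "sdist k k' \<le> pi - sph_thickness W"
    if "k' \<in> support_centers W" "k \<noteq> k'" "k \<noteq> - k'" for k'
  proof -
    have "sph_thickness W \<le> pi - sdist k k'"
      unfolding thick using that by (intro cInf_lower bdd) blast
    then show ?thesis by simp
  qed
  show "sdist k k' \<le> pi - sph_thickness W" if k': "k' \<in> support_centers W"
  proof (cases "k = k'")
    case True
    then have "sdist k k' = 0" using S[OF k] by (simp add: sdist_def norm_eq_1)
    then show ?thesis using le[OF k1] sdist_bounds(1)[OF S[OF k] S[OF k1(1)]] by simp
  next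
    case False
    moreover have "k \<noteq> - k'" using x0(2)[OF k] x0(2)[OF k'] by auto
    ultimately show ?thesis using le k' by blast
  qed
  show "\<exists>k'\<in>support_centers W. e < sdist k k'" if "e < pi - sph_thickness W"
  proof -
    have "Inf ?D < pi - e" using that thick by simp
    then obtain t where "t \<in> ?D" "t < pi - e" using cInf_lessD[OF ne] by blast
    then show ?thesis by force
  qed
qed

section \<open>The enclosing disk\<close>

theorem theorem5p1:
  fixes W :: "(real^3) set"
  assumes "sph_constant_width W"
    and "sph_thickness W \<ge> pi / 2"
  shows "\<exists>c\<in>S2. W \<subseteq> sph_disk c
           (sph_thickness W + arcsin (2 * sqrt 3 / 3 * cos (sph_thickness W / 2)) - pi / 2)"
proof -
  define B where "B = support_centers W"
  define d where "d = pi - sph_thickness W"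
  define R where "R = arcsin (2 * sqrt 3 / 3 * sin (d / 2))"
  have body: "sph_convex_body W" using assms by (simp add: sph_constant_width_def)
  then have conv: "sph_convex W" and sub: "W \<subseteq> S2"
    by (auto simp: sph_convex_body_def sph_convex_def)
  have comp: "compact W" by (rule compact_sph_convex_body[OF body])
  obtain x0 where x0: "x0 \<in> W" "\<And>k. k \<in> B \<Longrightarrow> 0 < k \<bullet> x0"
    using ex_common_positive_point[OF body] unfolding B_def by blast
  have B: "compact B" "B \<noteq> {}" "B \<subseteq> S2"
    unfolding B_def
    using compact_support_centers[OF comp] support_centers_nonempty[OF comp _ conv] x0(1)
    by (auto simp: support_centers_def)
  have "convex hull B \<subseteq> {v. 0 < x0 \<bullet> v}"
    using x0(2) by (intro hull_minimal convex_halfspace_gt) (auto simp: inner_commute)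
  then have B0: "0 \<notin> convex hull B" by auto
  have diam: "sdist k k' \<le> d" if "k \<in> B" "k' \<in> B" for k k'
    using sdist_support_centers_le[OF assms(1)] that unfolding B_def d_def by blast
  have far: "\<exists>k'\<in>B. e < sdist k k'" if "k \<in> B" "e < d" for k e
    using ex_far_support_center[OF assms(1)] that unfolding B_def d_def by blast
  have d_upper: "d \<le> pi / 2" using assms(2) by (simp add: d_def)
  then have d23: "d \<le> 2 * pi / 3" using pi_gt_zero by linarith
  have d_lower: "0 \<le> d"
    using B(2,3) diam sdist_bounds(1) by (meson ex_in_conv order_trans subsetD)
  obtain z where z: "z \<in> convex hull B" "z \<noteq> 0" "\<And>a. a \<in> B \<Longrightarrow> sdist (sgn z) a \<le> R"
    using spherical_jung_disk[OF B B0 d_lower d23 diam] unfolding R_def by metis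
  define c where "c = sgn z"
  have cS: "c \<in> S2" unfolding c_def by (rule sgn_in_S2[OF z(2)])
  have c_nonneg: "0 \<le> c \<bullet> x" if "x \<in> W" for x
  proof -
    have "convex hull B \<subseteq> {v. 0 \<le> x \<bullet> v}"
      using that by (intro hull_minimal convex_halfspace_ge)
        (auto simp: B_def support_centers_def inner_commute)
    then have "0 \<le> x \<bullet> c" using z(1) by (auto simp: c_def inner_sgn)
    then show ?thesis by (simp add: inner_commute)
  qed
  obtain y where y: "y \<in> W" "\<And>x. x \<in> W \<Longrightarrow> c \<bullet> y \<le> c \<bullet> x"
    using continuous_attains_inf[OF comp, of "\<lambda>x. c \<bullet> x"] x0(1)
    by (force intro: continuous_intros)
  have yS: "y \<in> S2" using y(1) sub by blast
  have R0: "0 \<le> R"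
    using z(3) B(2,3) sdist_bounds(1)[OF cS] unfolding c_def
    by (meson ex_in_conv order_trans subsetD)
  have cy_upper: "sdist c y \<le> pi / 2"
    using arccos_le_pi2[OF c_nonneg[OF y(1)] inner_S2_bounds(2)[OF cS yS]] by (simp only: sdist_def)
  have cy: "sdist c y \<le> pi / 2 - d + R"
  proof (rule ccontr)
    assume "\<not> sdist c y \<le> pi / 2 - d + R"
    then have gap: "(pi / 2 - sdist c y) + R < d" by simp
    then have "0 < sdist c y" using R0 d_upper by linarith
    then have "y \<noteq> c" using yS by (auto simp: sdist_def norm_eq_1)
    moreover have "y \<noteq> - c" using c_nonneg[OF y(1)] cS by (auto simp: norm_eq_1)
    ultimately have yc: "y \<in> S2" "c \<in> S2" "y \<noteq> c" "y \<noteq> - c" using yS cS by auto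
    \<comment> \<open>Rotating \<open>c\<close> away from \<open>y\<close> until \<open>y\<close> reaches the boundary circle yields a supporting
      hemisphere, because \<open>y\<close> is farthest from \<open>c\<close>.\<close>
    define k where "k = polar_projection y c"
    have kS: "k \<in> S2" unfolding k_def by (rule polar_projection_in_S2[OF yc])
    have "0 \<le> k \<bullet> x" if x: "x \<in> W" for x
    proof -
      have "(y \<bullet> c) * (x \<bullet> y) \<le> (y \<bullet> c) * 1"
        using c_nonneg[OF y(1)] inner_S2_bounds[of x y] x sub yS
        by (intro mult_left_mono) (auto simp: inner_commute)
      also have "\<dots> \<le> x \<bullet> c" using y(2)[OF x] by (simp add: inner_commute)
      finally have "0 \<le> x \<bullet> k"
        unfolding k_def inner_polar_projection[OF yc] using sqrt_component_pos[OF yc] by simp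
      then show ?thesis by (simp add: inner_commute)
    qed
    moreover have "k \<bullet> y = 0"
      using inner_polar_projection_pole[OF yc] by (simp add: k_def inner_commute)
    ultimately have kB: "k \<in> B" using kS y(1) unfolding B_def support_centers_def by blast
    have "c \<bullet> k = sqrt (1 - (c \<bullet> y)\<^sup>2)"
      unfolding k_def inner_polar_projection_self[OF yc] by (simp add: inner_commute)
    also have "\<dots> = sin (sdist c y)"
      using abs_inner_S2_le_1[OF cS yS] by (simp add: sdist_def sin_arccos_abs)
    finally have "c \<bullet> k = cos (pi / 2 - sdist c y)" by (simp add: cos_diff)
    then have ck: "sdist c k \<le> pi / 2 - sdist c y"
      using cy_upper sdist_bounds[OF cS yS] by (intro sdist_le_cos cS kS) auto
    obtain k' where k': "k' \<in> B" "(pi / 2 - sdist c y) + R < sdist k k'"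
      using far[OF kB gap] by blast
    have "sdist k k' \<le> sdist k c + sdist c k'"
      using sdist_triangle k' kS cS B(3) by blast
    also have "\<dots> \<le> (pi / 2 - sdist c y) + R"
      using ck z(3)[OF k'(1)] by (simp add: c_def sdist_commute[of k])
    finally show False using k'(2) by simp
  qed
  have radius: "sph_thickness W + arcsin (2 * sqrt 3 / 3 * cos (sph_thickness W / 2)) - pi / 2
      = pi / 2 - d + R"
  proof -
    have half: "sph_thickness W / 2 = pi / 2 - d / 2" by (simp add: d_def field_simps)
    have "cos (sph_thickness W / 2) = sin (d / 2)" unfolding half cos_diff by simp
    then show ?thesis by (simp add: R_def d_def)
  qed
  have "W \<subseteq> sph_disk c (pi / 2 - d + R)"
  proof
    fix x assume x: "x \<in> W"
    then have xS: "x \<in> S2" using sub by blast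
    have "sdist c x \<le> sdist c y"
      unfolding sdist_def using y(2)[OF x] inner_S2_bounds[OF cS xS] inner_S2_bounds[OF cS yS]
      by (intro arccos_le_arccos) auto
    then show "x \<in> sph_disk c (pi / 2 - d + R)" using cy xS by (simp add: sph_disk_def)
  qed
  then show ?thesis using cS unfolding radius by blast
qed

end
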